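(* The class $\mathcal{K}$ of all supermartingales on a filtered probability space $(\Omega,\mathcal{F},(\mathcal{F}_t)_{t\ge 0},P)$ satisfying the usual conditions satisfies the weak interpolation property: for every pair of nonempty finite subsets $E,F\subset\mathcal{K}$ with $X\le Y$ for all $X\in E$ and $Y\in F$, there exists a process $Z$ that is a difference of two supermartingales such that $X\le Z\le Y$ for all $X\in E$ and $Y\in F$. That is, in particular, for two supermartingales $X$ and $Y$ with $X\le Y$, there exists a difference $Z$ of two supermartingales such that $X\le Z\le Y$.
   Context: All processes are real-valued, indexed by $t\in[0,\infty)$, defined on the fixed filtered probability space (with filtration satisfying the usual conditions), and c\`adl\`ag (right-continuous with left-hand limits); supermartingales are with respect to $(\mathcal{F}_t)_{t\ge0}$. For processes $X,Y$, write $X\le Y$ if for every $t\ge 0$ one has $X_t\le Y_t$ almost surely. A subset $S$ of an ordered vector space has the weak interpolation property if for all nonempty finite $E,F\subset S$ with every element of $E$ at most every element of $F$ there is a vector $x$ in the linear span $\langle S\rangle$ of $S$ with $e\le x\le f$ for all $e\in E$, $f\in F$. The linear span of $\mathcal{K}$ is $\mathcal{K}-\mathcal{K}$, the set of differences of two supermartingales. *)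

theory Defs
  imports "HOL-Probability.Probability" "HOL-Library.Function_Algebras"
begin

text \<open>Time is the half-line \<open>[0, \<infinity>)\<close>, encoded as the reals \<open>t \<ge> 0\<close>; the values of a filtration or
  of a process at negative times are never used.\<close>

locale usual_filtered_prob_space = prob_space M + complete_measure M
  for M :: "'a measure" and F :: "real \<Rightarrow> 'a measure" +
  assumes subalgebra_F: "\<And>t. 0 \<le> t \<Longrightarrow> subalgebra M (F t)"
    and sets_F_mono: "\<And>s t. 0 \<le> s \<Longrightarrow> s \<le> t \<Longrightarrow> sets (F s) \<subseteq> sets (F t)"
    and null_sets_F: "null_sets M \<subseteq> sets (F 0)"
    and right_continuous_F: "\<And>t. 0 \<le> t \<Longrightarrow> sets (F t) = (\<Inter>s\<in>{t<..}. sets (F s))"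

type_synonym 'a process = "real \<Rightarrow> 'a \<Rightarrow> real"

definition cadlag :: "'a measure \<Rightarrow> 'a process \<Rightarrow> bool" where
  "cadlag M X \<longleftrightarrow> (\<forall>\<omega>\<in>space M.
     (\<forall>t\<ge>0. continuous (at_right t) (\<lambda>s. X s \<omega>)) \<and>
     (\<forall>t>0. \<exists>l. ((\<lambda>s. X s \<omega>) \<longlongrightarrow> l) (at_left t)))"

definition supermartingale :: "'a measure \<Rightarrow> (real \<Rightarrow> 'a measure) \<Rightarrow> 'a process \<Rightarrow> bool" where
  "supermartingale M F X \<longleftrightarrow>
     cadlag M X \<and>
     (\<forall>t\<ge>0. X t \<in> borel_measurable (F t)) \<and>
     (\<forall>t\<ge>0. integrable M (X t)) \<and>
     (\<forall>s t. 0 \<le> s \<and> s \<le> t \<longrightarrow> (AE \<omega> in M. real_cond_exp M (F s) (X t) \<omega> \<le> X s \<omega>))"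

definition supermartingales :: "'a measure \<Rightarrow> (real \<Rightarrow> 'a measure) \<Rightarrow> 'a process set" where
  "supermartingales M F = {X. supermartingale M F X}"

text \<open>A preorder on processes, and a partial order once processes are identified with their
  modifications (for cadlag processes: up to indistinguishability).\<close>

definition process_le :: "'a measure \<Rightarrow> 'a process \<Rightarrow> 'a process \<Rightarrow> bool" where
  "process_le M X Y \<longleftrightarrow> (\<forall>t\<ge>0. AE \<omega> in M. X t \<omega> \<le> Y t \<omega>)"

text \<open>Addition of processes is pointwise, from the function algebra instances; these do not provide
  scalar multiplication, so it is given explicitly.\<close>

definition process_scale :: "real \<Rightarrow> 'a process \<Rightarrow> 'a process" where
  "process_scale c X = (\<lambda>t \<omega>. c * X t \<omega>)"

interpretation process: vector_space process_scale
  by unfold_locales (auto simp: process_scale_def fun_eq_iff algebra_simps)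

text \<open>The weak interpolation property of a subset \<open>S\<close> of a vector space with scalar multiplication
  \<open>smul\<close> and order \<open>le\<close>, both explicit so that it applies to representatives of processes.\<close>

definition weak_interpolation_property ::
    "(real \<Rightarrow> 'v \<Rightarrow> 'v) \<Rightarrow> ('v \<Rightarrow> 'v \<Rightarrow> bool) \<Rightarrow> 'v::ab_group_add set \<Rightarrow> bool" where
  "weak_interpolation_property smul le S \<longleftrightarrow>
     (\<forall>A B. finite A \<and> A \<noteq> {} \<and> A \<subseteq> S \<and> finite B \<and> B \<noteq> {} \<and> B \<subseteq> S \<and>
            (\<forall>a\<in>A. \<forall>b\<in>B. le a b) \<longrightarrow>
       (\<exists>x\<in>module.span smul S. \<forall>a\<in>A. \<forall>b\<in>B. le a x \<and> le x b))"

definition supermartingale_differences ::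
    "'a measure \<Rightarrow> (real \<Rightarrow> 'a measure) \<Rightarrow> 'a process set" where
  "supermartingale_differences M F =
     {U - V | U V. U \<in> supermartingales M F \<and> V \<in> supermartingales M F}"

end

theory Submission
  imports Defs
begin

text \<open>The pointwise minimum of finitely many supermartingales is again a supermartingale, so
  \<open>Z = min B\<close> already interpolates between \<open>A\<close> and \<open>B\<close>.\<close>

lemma cadlag_min:
  assumes X: "cadlag M X" and Y: "cadlag M Y"
  shows "cadlag M (\<lambda>t \<omega>. min (X t \<omega>) (Y t \<omega>))"
  unfolding cadlag_def
proof (intro ballI conjI allI impI)
  fix \<omega> and t :: real
  assume \<omega>: "\<omega> \<in> space M"
  { assume "0 \<le> t"
    with X Y \<omega> show "continuous (at_right t) (\<lambda>s. min (X s \<omega>) (Y s \<omega>))"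
      unfolding cadlag_def by (intro continuous_min) auto }
  { assume "0 < t"
    with X Y \<omega> obtain l m where "((\<lambda>s. X s \<omega>) \<longlongrightarrow> l) (at_left t)"
        "((\<lambda>s. Y s \<omega>) \<longlongrightarrow> m) (at_left t)"
      unfolding cadlag_def by meson
    then have "((\<lambda>s. min (X s \<omega>) (Y s \<omega>)) \<longlongrightarrow> min l m) (at_left t)"
      by (rule tendsto_min)
    then show "\<exists>l. ((\<lambda>s. min (X s \<omega>) (Y s \<omega>)) \<longlongrightarrow> l) (at_left t)" .. }
qed

context usual_filtered_prob_space
begin

text \<open>This gives access to the conditional expectation lemmas: on a probability space every
  \<open>F t\<close> is a subalgebra of a finite measure. The condition \<open>0 \<le> t\<close>
  stays because the filtration is constrained only at nonnegative times.\<close>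

lemma finite_measure_subalgebra_F: "0 \<le> t \<Longrightarrow> finite_measure_subalgebra M (F t)"
  by (intro finite_measure_subalgebra.intro finite_measure_subalgebra_axioms.intro
      finite_measure_axioms subalgebra_F)

text \<open>Serves as the subtrahend that exhibits each supermartingale as a difference of
  two.\<close>

lemma supermartingale_zero: "supermartingale M F 0"
proof -
  have "AE \<omega> in M. real_cond_exp M (F s) (0 t) \<omega> \<le> 0" if "0 \<le> s" for s and t :: real
  proof -
    interpret finite_measure_subalgebra M "F s"
      using that by (rule finite_measure_subalgebra_F)
    \<comment> \<open>A constant is \<open>F s\<close>-measurable and integrable, so conditioning
      leaves it unchanged, though only almost everywhere, since \<open>real_cond_exp\<close> is one
      chosen version.\<close>
    have "AE \<omega> in M. real_cond_exp M (F s) (\<lambda>_. 0) \<omega> = 0"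
      by (rule real_cond_exp_F_meas) auto
    then show ?thesis
      unfolding zero_fun_def by eventually_elim simp
  qed
  then show ?thesis
    by (auto simp: supermartingale_def cadlag_def zero_fun_def)
qed

text \<open>The minimum lies below both processes, so by monotonicity its conditional expectation
  lies almost everywhere below those of \<open>X t\<close> and \<open>Y t\<close>, hence below both
  \<open>X s\<close> and \<open>Y s\<close>. Measurability, integrability and cadlag paths all pass
  to a minimum.\<close>

lemma supermartingale_min:
  assumes X: "supermartingale M F X" and Y: "supermartingale M F Y"
  shows "supermartingale M F (\<lambda>t \<omega>. min (X t \<omega>) (Y t \<omega>))"
proof -
  have int: "integrable M (\<lambda>\<omega>. min (X t \<omega>) (Y t \<omega>))" if "0 \<le> t" for t
    using X Y that by (auto simp: supermartingale_def)
  have "AE \<omega> in M. real_cond_exp M (F s) (\<lambda>\<omega>. min (X t \<omega>) (Y t \<omega>)) \<omega> \<le> min (X s \<omega>) (Y s \<omega>)"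
    if st: "0 \<le> s" "s \<le> t" for s t
  proof -
    interpret finite_measure_subalgebra M "F s"
      using st(1) by (rule finite_measure_subalgebra_F)
    have "integrable M (X t)" "integrable M (Y t)"
      using X Y st by (auto simp: supermartingale_def)
    then have "AE \<omega> in M. real_cond_exp M (F s) (\<lambda>\<omega>. min (X t \<omega>) (Y t \<omega>)) \<omega> \<le> real_cond_exp M (F s) (X t) \<omega>"
      "AE \<omega> in M. real_cond_exp M (F s) (\<lambda>\<omega>. min (X t \<omega>) (Y t \<omega>)) \<omega> \<le> real_cond_exp M (F s) (Y t) \<omega>"
      using int[of t] st by (intro real_cond_exp_mono; simp)+
    moreover have "AE \<omega> in M. real_cond_exp M (F s) (X t) \<omega> \<le> X s \<omega>"
      "AE \<omega> in M. real_cond_exp M (F s) (Y t) \<omega> \<le> Y s \<omega>"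
      using X Y st by (auto simp: supermartingale_def)
    ultimately show ?thesis
      by eventually_elim auto
  qed
  moreover have "(\<lambda>\<omega>. min (X t \<omega>) (Y t \<omega>)) \<in> borel_measurable (F t)" if "0 \<le> t" for t
    using X Y that by (intro borel_measurable_min) (auto simp: supermartingale_def)
  moreover have "cadlag M (\<lambda>t \<omega>. min (X t \<omega>) (Y t \<omega>))"
    using X Y by (intro cadlag_min) (auto simp: supermartingale_def)
  ultimately show ?thesis
    using int by (simp add: supermartingale_def)
qed

text \<open>Induction on \<open>B\<close>, taking the minimum of the new element with the infimum
  found so far. The infimum is described by its universal property because \<open>process_le\<close>
  is only a preorder on representatives. Lower bounds \<open>X\<close> range over all
  processes.\<close>

lemma supermartingales_finite_infimum:
  assumes "finite B" "B \<noteq> {}" "B \<subseteq> supermartingales M F"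
  shows "\<exists>Z\<in>supermartingales M F. (\<forall>Y\<in>B. process_le M Z Y) \<and>
    (\<forall>X. (\<forall>Y\<in>B. process_le M X Y) \<longrightarrow> process_le M X Z)"
  using assms
proof (induction rule: finite_ne_induct)
  case (singleton Y)
  then show ?case by (auto simp: process_le_def)
next
  case (insert Y B)
  then obtain Z where Z: "Z \<in> supermartingales M F" "\<forall>Y\<in>B. process_le M Z Y"
    "\<And>X. \<forall>Y\<in>B. process_le M X Y \<Longrightarrow> process_le M X Z"
    by auto
  let ?W = "\<lambda>t \<omega>. min (Y t \<omega>) (Z t \<omega>)"
  have "?W \<in> supermartingales M F"
    using insert.prems Z(1) by (auto simp: supermartingales_def intro: supermartingale_min)
  moreover have "process_le M ?W V" if "V \<in> insert Y B" for V
    using that Z(2) by (fastforce simp: process_le_def)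
  \<comment> \<open>At a fixed time, lying below the minimum is the conjunction of two almost sure
    inequalities, so two null sets are merged.\<close>
  moreover have "process_le M X ?W" if "\<forall>V\<in>insert Y B. process_le M X V" for X
    using that Z(3)[of X] by (simp add: process_le_def)
  ultimately show ?case
    by blast
qed

end

theorem theorem3p5:
  fixes M :: "'a measure" and F :: "real \<Rightarrow> 'a measure"
  assumes "usual_filtered_prob_space M F"
  shows "weak_interpolation_property process_scale (process_le M) (supermartingales M F) \<and>
    (\<forall>A B. finite A \<and> A \<noteq> {} \<and> A \<subseteq> supermartingales M F \<and>
           finite B \<and> B \<noteq> {} \<and> B \<subseteq> supermartingales M F \<and>
           (\<forall>X\<in>A. \<forall>Y\<in>B. process_le M X Y) \<longrightarrow>
       (\<exists>Z\<in>supermartingale_differences M F.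
          \<forall>X\<in>A. \<forall>Y\<in>B. process_le M X Z \<and> process_le M Z Y)) \<and>
    (\<forall>X Y. supermartingale M F X \<and> supermartingale M F Y \<and> process_le M X Y \<longrightarrow>
       (\<exists>Z\<in>supermartingale_differences M F. process_le M X Z \<and> process_le M Z Y))"
proof -
  interpret usual_filtered_prob_space M F by (fact assms)
  \<comment> \<open>Each element of \<open>A\<close> is a lower bound of \<open>B\<close>, hence
    lies below the infimum of \<open>B\<close>. The interpolant is itself a supermartingale, which
    is stronger than lying in the span or being a difference; all three claims follow from
    this.\<close>
  have inter: "\<exists>Z\<in>supermartingales M F. \<forall>X\<in>A. \<forall>Y\<in>B. process_le M X Z \<and> process_le M Z Y"
    if "finite B" "B \<noteq> {}" "B \<subseteq> supermartingales M F" "\<forall>X\<in>A. \<forall>Y\<in>B. process_le M X Y" for A B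
    using supermartingales_finite_infimum[OF that(1-3)] that(4) by meson
  have diff: "supermartingales M F \<subseteq> supermartingale_differences M F"
  proof
    fix X assume "X \<in> supermartingales M F"
    then show "X \<in> supermartingale_differences M F"
      unfolding supermartingale_differences_def supermartingales_def
      \<comment> \<open>The decomposition used is \<open>X = X - 0\<close>.\<close>
      by (intro CollectI exI[of _ X] exI[of _ 0]) (simp add: supermartingale_zero)
  qed
  have "\<exists>Z\<in>process.span (supermartingales M F).
      \<forall>X\<in>A. \<forall>Y\<in>B. process_le M X Z \<and> process_le M Z Y"
    if "finite B" "B \<noteq> {}" "B \<subseteq> supermartingales M F" "\<forall>X\<in>A. \<forall>Y\<in>B. process_le M X Y" for A B
    using inter[OF that] by (blast intro: process.span_base)
  then have "weak_interpolation_property process_scale (process_le M) (supermartingales M F)"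
    unfolding weak_interpolation_property_def by simp
  moreover have interpolation: "\<exists>Z\<in>supermartingale_differences M F.
      \<forall>X\<in>A. \<forall>Y\<in>B. process_le M X Z \<and> process_le M Z Y"
    if "finite B" "B \<noteq> {}" "B \<subseteq> supermartingales M F" "\<forall>X\<in>A. \<forall>Y\<in>B. process_le M X Y" for A B
    using inter[OF that] diff by blast
  moreover have "\<exists>Z\<in>supermartingale_differences M F. process_le M X Z \<and> process_le M Z Y"
    if "supermartingale M F Y" "process_le M X Y" for X Y
    \<comment> \<open>The upper family comes first here: \<open>B\<close> is \<open>{Y}\<close> and
      \<open>A\<close> is \<open>{X}\<close>.\<close>
    using interpolation[of "{Y}" "{X}"] that by (simp add: supermartingales_def)
  ultimately show ?thesis
    by (intro conjI allI impI) simp_all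
qed

end
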